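(* Let $l\ge 2$ be an integer. Let $G$ be a connected $d$-regular graph with $|V(G)|\ge l+1$ and $d\ge 3$. If \[ \lambda_l(G) < \begin{cases} \frac{d-2+\sqrt{d^2+12}}{2}, & \text{if } d \text{ is even},\\ \frac{d-2+\sqrt{d^2+8}}{2}, & \text{if } d \text{ is odd},\end{cases} \] then $\kappa_l(G)\ge 2$.
   Context: All graphs are finite, undirected and simple. For a graph $G$ of order $n$, $\lambda_1(G)\ge\lambda_2(G)\ge\dots\ge\lambda_n(G)$ denote the eigenvalues of its adjacency matrix (with multiplicity). For an integer $l\ge 2$, the $l$-connectivity $\kappa_l(G)$ is the minimum number of vertices of $G$ whose removal produces a disconnected graph with at least $l$ components or a graph with fewer than $l$ vertices. *)

theory Defs
  imports
    Complex_Main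
    "Graph_Theory.Digraph_Component"
    "Jordan_Normal_Form.Char_Poly"
begin

text \<open>
  Finite undirected simple graphs are the locale \<open>graph\<close> of the AFP entry Graph_Theory: finite
  digraphs without loops and parallel arcs whose arc relation is symmetric, so that every
  undirected edge is represented by its two orientations.  Hence the out-degree of a vertex is
  its number of neighbours, and the strongly connected components (\<open>pre_digraph.sccs\<close>) are the
  connected components of the undirected graph.
\<close>

definition regular_graph :: "('a, 'b) pre_digraph \<Rightarrow> nat \<Rightarrow> bool" where
  "regular_graph G d \<longleftrightarrow> (\<forall>v \<in> verts G. out_degree G v = d)"

definition adjacency_matrix :: "('a, 'b) pre_digraph \<Rightarrow> 'a list \<Rightarrow> real mat" where
  "adjacency_matrix G vs =
     mat (length vs) (length vs) (\<lambda>(i, j). if (vs ! i, vs ! j) \<in> arcs_ends G then 1 else 0)"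

text \<open>
  Different enumerations of the vertices give adjacency matrices that are similar by a permutation
  matrix, so the choice of the enumeration does not affect the eigenvalues.
\<close>

definition vertex_enum :: "('a, 'b) pre_digraph \<Rightarrow> 'a list" where
  "vertex_enum G = (SOME vs. distinct vs \<and> set vs = verts G)"

text \<open>
  \<open>proots\<close> is the multiset of roots of a polynomial, counted with multiplicity.  The adjacency
  matrix is real symmetric, so its characteristic polynomial splits over the reals and the list
  below has one entry for each vertex.
\<close>

definition graph_eigenvalues :: "('a, 'b) pre_digraph \<Rightarrow> real list" where
  "graph_eigenvalues G =
     rev (sorted_list_of_multiset (proots (char_poly (adjacency_matrix G (vertex_enum G)))))"

text \<open>The eigenvalues are numbered from 1, in decreasing order.\<close>

definition graph_lambda :: "nat \<Rightarrow> ('a, 'b) pre_digraph \<Rightarrow> real" where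
  "graph_lambda k G = graph_eigenvalues G ! (k - 1)"

definition remove_verts :: "('a, 'b) pre_digraph \<Rightarrow> 'a set \<Rightarrow> ('a, 'b) pre_digraph" where
  "remove_verts G S = G \<restriction> (verts G - S)"

text \<open>
  Removing all vertices leaves fewer than \<open>l\<close> vertices when \<open>l\<close> is positive, so the minimum
  is attained.
\<close>

definition l_connectivity :: "nat \<Rightarrow> ('a, 'b) pre_digraph \<Rightarrow> nat" where
  "l_connectivity l G = (LEAST k. \<exists>S \<subseteq> verts G. card S = k \<and>
     (\<not> Digraph_Component.connected (remove_verts G S) \<and>
        card (pre_digraph.sccs (remove_verts G S)) \<ge> l
      \<or> card (verts (remove_verts G S)) < l))"

end

theory Submission
  imports Defs "Jordan_Normal_Form.Spectral_Radius"
begin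

text \<open>
  Deleting at most one vertex from a connected graph with at least \<open>l + 1\<close> vertices leaves at least
  \<open>l\<close> vertices, and deleting none leaves it connected.  So if the \<open>l\<close>-connectivity were below 2,
  there would be a vertex \<open>v\<close> whose deletion leaves at least \<open>l\<close> components.  The theorem follows
  from the claim that \<open>\<lambda>\<^sub>l\<close> then reaches
  \<open>\<mu> = (d - 2 + sqrt (d\<^sup>2 + 4 r)) / 2\<close> with \<open>r = 3\<close> for even \<open>d\<close> and \<open>r = 2\<close> for odd \<open>d\<close>.

  Let \<open>C\<close> be the vertex set of such a component, and let \<open>t\<close> be the number of neighbours of \<open>v\<close> in
  \<open>C\<close>.  Every component contains a neighbour of \<open>v\<close>, and there are at least two components, so
  \<open>t \<le> d - 1\<close>.  Counting degrees inside \<open>C\<close> shows that \<open>t\<close> is even when \<open>d\<close> is, so \<open>t \<le> d - 2\<close> in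
  that case.  Both bounds say \<open>t + r \<le> d + 1\<close>, and this inequality yields a nonzero weight
  \<open>x\<close> on \<open>C\<close> whose Rayleigh quotient is at least \<open>\<mu>\<close> (\<open>test_vector_exists\<close>).
  To see this, note that \<open>C\<close> has at least \<open>d + 1\<close> elements.  The extremal case is
  \<open>|C| = d + 1\<close> and \<open>t + r = d + 1\<close>: then \<open>C\<close> is a complete graph from which only edges between
  neighbours of \<open>v\<close> are missing, the partition of \<open>C\<close> into neighbours and non-neighbours of \<open>v\<close> is
  equitable, and \<open>\<mu>\<close> is an eigenvalue of its quotient matrix.  In every other case already the
  constant weight suffices, because the average degree \<open>d - t / |C|\<close> inside \<open>C\<close> is at least \<open>\<mu>\<close>.

  Weights on different components are orthogonal, both for the standard inner product and for the
  adjacency form, since no edge joins two components.  Hence \<open>l\<close> components give an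
  \<open>l\<close>-dimensional space on which the adjacency form is at least \<open>\<mu>\<close> times the squared norm
  (\<open>graph_lambda_ge\<close>).  By the Courant-Fischer principle
  (\<open>eigenvalue_count_of_quadratic_form\<close>), which rests on the orthogonal diagonalization of
  symmetric real matrices, at least \<open>l\<close> eigenvalues are then at least \<open>\<mu>\<close>.
\<close>

section \<open>Symmetric real matrices\<close>

text \<open>
  Split a complex eigenvector into real and imaginary part \<open>x + i y\<close>.  Symmetry of \<open>A\<close> compares
  \<open>y \<bullet> A x\<close> with \<open>x \<bullet> A y\<close> and gives \<open>Im z * (x \<bullet> x + y \<bullet> y) = 0\<close>, so the eigenvalue \<open>z\<close> is real
  and \<open>x\<close> or \<open>y\<close> is a real eigenvector.
\<close>

lemma real_symmetric_eigenvector_exists: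
  fixes A :: "real mat"
  assumes A: "A \<in> carrier_mat n n" and sym: "transpose_mat A = A" and n: "n > 0"
  obtains a u where "u \<in> carrier_vec n" "u \<bullet> u = 1" "A *\<^sub>v u = a \<cdot>\<^sub>v u"
proof -
  define B where "B = map_mat complex_of_real A"
  have B: "B \<in> carrier_mat n n" using A by (auto simp: B_def)
  from spectrum_non_empty[OF B n] obtain z where "eigenvalue B z"
    by (auto simp: spectrum_def)
  then obtain w where w: "w \<in> carrier_vec n" "w \<noteq> 0\<^sub>v n" "B *\<^sub>v w = z \<cdot>\<^sub>v w"
    using B by (auto simp: eigenvalue_def eigenvector_def)
  define x where "x = map_vec Re w"
  define y where "y = map_vec Im w"
  have x: "x \<in> carrier_vec n" and y: "y \<in> carrier_vec n" using w by (auto simp: x_def y_def)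
  have entry: "(\<Sum>j<n. complex_of_real (A $$ (i,j)) * w $ j) = z * w $ i" if "i < n" for i
    using arg_cong[OF w(3), of "\<lambda>v. v $ i"] that A B w(1)
    by (auto simp: B_def scalar_prod_def lessThan_atLeast0)
  have Ax: "A *\<^sub>v x = Re z \<cdot>\<^sub>v x - Im z \<cdot>\<^sub>v y"
  proof (rule eq_vecI)
    fix i assume "i < dim_vec (Re z \<cdot>\<^sub>v x - Im z \<cdot>\<^sub>v y)"
    hence i: "i < n" using x y by auto
    from arg_cong[OF entry[OF i], of Re]
    show "(A *\<^sub>v x) $ i = (Re z \<cdot>\<^sub>v x - Im z \<cdot>\<^sub>v y) $ i"
      using i A w(1) x y by (auto simp: x_def y_def scalar_prod_def lessThan_atLeast0)
  qed (use A x y in auto)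
  have Ay: "A *\<^sub>v y = Im z \<cdot>\<^sub>v x + Re z \<cdot>\<^sub>v y"
  proof (rule eq_vecI)
    fix i assume "i < dim_vec (Im z \<cdot>\<^sub>v x + Re z \<cdot>\<^sub>v y)"
    hence i: "i < n" using x y by auto
    from arg_cong[OF entry[OF i], of Im]
    show "(A *\<^sub>v y) $ i = (Im z \<cdot>\<^sub>v x + Re z \<cdot>\<^sub>v y) $ i"
      using i A w(1) x y by (auto simp: x_def y_def scalar_prod_def lessThan_atLeast0)
  qed (use A x y in auto)
  have nonneg: "v \<bullet> v \<ge> 0" for v :: "real vec" by (auto simp: scalar_prod_def intro: sum_nonneg)
  have pos: "v \<bullet> v > 0" if v: "v \<in> carrier_vec n" and v0: "v \<noteq> 0\<^sub>v n" for v :: "real vec"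
  proof -
    obtain i where i: "i < n" "v $ i \<noteq> 0" using v v0 by (metis eq_vecI carrier_vecD index_zero_vec)
    have "0 < (\<Sum>i = 0..<n. v $ i * v $ i)"
      by (rule sum_pos2[of _ i]) (use i in \<open>auto simp: less_le\<close>)
    thus ?thesis using v by (auto simp: scalar_prod_def)
  qed
  have "(A *\<^sub>v y) \<bullet> x = y \<bullet> (A *\<^sub>v x)"
    using transpose_vec_mult_scalar[OF A x y] sym by simp
  hence "Im z * (x \<bullet> x + y \<bullet> y) = 0"
    unfolding Ax Ay using x y comm_scalar_prod[OF x y]
    by (simp add: add_scalar_prod_distrib[of _ n] scalar_prod_minus_distrib[of _ n] algebra_simps)
  moreover have "x \<bullet> x + y \<bullet> y > 0"
  proof -
    have "x \<noteq> 0\<^sub>v n \<or> y \<noteq> 0\<^sub>v n"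
    proof (rule ccontr)
      assume "\<not> ?thesis"
      hence "Re (w $ i) = 0 \<and> Im (w $ i) = 0" if "i < n" for i
        using that w(1) by (metis carrier_vecD index_map_vec(1) index_zero_vec(1) x_def y_def)
      hence "w = 0\<^sub>v n" using w(1) by (intro eq_vecI) (auto simp: complex_eq_iff)
      thus False using w(2) by simp
    qed
    thus ?thesis using pos[OF x] pos[OF y] nonneg[of x] nonneg[of y] by linarith
  qed
  ultimately have im: "Im z = 0" by simp
  have real: "A *\<^sub>v x = Re z \<cdot>\<^sub>v x" "A *\<^sub>v y = Re z \<cdot>\<^sub>v y"
    unfolding Ax Ay im using x y by auto
  obtain v where v: "v \<in> carrier_vec n" "v \<bullet> v > 0" "A *\<^sub>v v = Re z \<cdot>\<^sub>v v"
    using real x y \<open>x \<bullet> x + y \<bullet> y > 0\<close> nonneg[of x] nonneg[of y]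
    by (metis add_0 less_eq_real_def)
  define c where "c = 1 / sqrt (v \<bullet> v)"
  have "(c \<cdot>\<^sub>v v) \<bullet> (c \<cdot>\<^sub>v v) = 1"
    using v by (simp add: c_def)
  moreover have "A *\<^sub>v (c \<cdot>\<^sub>v v) = Re z \<cdot>\<^sub>v (c \<cdot>\<^sub>v v)"
    using v A by (simp add: mult_mat_vec smult_smult_assoc mult.commute)
  ultimately show ?thesis using that[of "c \<cdot>\<^sub>v v" "Re z"] v(1) by auto
qed

text \<open>
  A unit vector becomes the first vector of an orthonormal basis: the reflection in the hyperplane
  orthogonal to \<open>w = u - e\<close>, where \<open>e\<close> is the first unit vector, exchanges \<open>e\<close> and \<open>u\<close>.
\<close>

lemma householder_reflection_exists:
  fixes u :: "real vec"
  assumes u: "u \<in> carrier_vec n" and unit: "u \<bullet> u = 1" and n: "n > 0"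
  obtains H where "H \<in> carrier_mat n n" "transpose_mat H = H" "H * H = 1\<^sub>m n"
    "H *\<^sub>v unit_vec n 0 = u"
proof -
  define w where "w = (\<lambda>i. u $ i - (if i = 0 then 1 else 0))"
  define s where "s = (\<Sum>i<n. w i * w i)"
  \<comment> \<open>If \<open>u\<close> is the first unit vector, then \<open>s = 0\<close>, hence \<open>c = 0\<close> and \<open>H\<close> is the identity.\<close>
  define c where "c = 2 / s"
  define H where "H = mat n n (\<lambda>(i,j). (if i = j then 1 else 0) - c * w i * w j)"
  have uu: "(\<Sum>i<n. u $ i * u $ i) = 1"
    using unit u by (simp add: scalar_prod_def lessThan_atLeast0)
  have "s = (\<Sum>i<n. u $ i * u $ i - 2 * (if i = 0 then u $ i else 0) + (if i = 0 then 1 else 0))"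
    unfolding s_def w_def by (intro sum.cong) (auto simp: algebra_simps)
  also have "\<dots> = 2 - 2 * u $ 0"
    using n by (simp add: sum.distrib sum_subtractf uu sum_distrib_left[symmetric])
  finally have s: "s = - 2 * w 0" by (simp add: w_def)
  have s0: "w i = 0" if "s = 0" "i < n" for i
    using that by (auto simp: s_def sum_nonneg_eq_0_iff)
  have "c * s * c = 2 * c" by (simp add: c_def)
  have H: "H \<in> carrier_mat n n" by (simp add: H_def)
  have "transpose_mat H = H" by (rule eq_matI) (auto simp: H_def)
  moreover have "H * H = 1\<^sub>m n"
  proof (rule eq_matI)
    fix i j assume ij: "i < dim_row (1\<^sub>m n)" "j < dim_col (1\<^sub>m n)"
    have "(H * H) $$ (i,j) = (\<Sum>k<n. ((if i = k then 1 else 0) - c * w i * w k) *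
       ((if k = j then 1 else 0) - c * w k * w j))"
      using ij by (simp add: H_def scalar_prod_def lessThan_atLeast0)
    also have "\<dots> = (\<Sum>k<n. (if k = i then (if i = j then 1 else 0) - c * w i * w j else 0)
       - (if k = j then c * w i * w j else 0) + c * c * w i * w j * (w k * w k))"
      by (intro sum.cong) (auto simp: algebra_simps)
    also have "\<dots> = (if i = j then 1 else 0) - 2 * c * w i * w j + c * c * w i * w j * s"
      using ij by (simp add: sum.distrib sum_subtractf sum_distrib_left[symmetric] s_def)
    also have "\<dots> = (if i = j then 1 else 0) - 2 * c * w i * w j + (c * s * c) * w i * w j"
      by simp
    also have "\<dots> = 1\<^sub>m n $$ (i,j)" unfolding \<open>c * s * c = 2 * c\<close> using ij by simp
    finally show "(H * H) $$ (i,j) = 1\<^sub>m n $$ (i,j)" .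
  qed (auto simp: H_def)
  moreover have "H *\<^sub>v unit_vec n 0 = u"
  proof (rule eq_vecI)
    fix i assume "i < dim_vec u"
    hence i: "i < n" using u by simp
    have "(H *\<^sub>v unit_vec n 0) $ i = H $$ (i,0)" using i n H by simp
    also have "\<dots> = (if i = 0 then 1 else 0) - c * w 0 * w i"
      using i n by (simp add: H_def)
    also have "\<dots> = (if i = 0 then 1 else 0) + w i"
      using s s0[OF _ i] by (cases "s = 0") (auto simp: c_def field_simps)
    finally show "(H *\<^sub>v unit_vec n 0) $ i = u $ i" by (simp add: w_def)
  qed (use u H in auto)
  ultimately show ?thesis using that H by blast
qed

text \<open>
  Conjugation with a Householder reflection turns an eigenvector into the first unit vector.  The
  first column of the new matrix is then zero below the diagonal, by symmetry so is the first row,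
  and the remaining block is a smaller symmetric matrix.
\<close>

theorem real_symmetric_diagonalization:
  fixes A :: "real mat"
  assumes "A \<in> carrier_mat n n" and "transpose_mat A = A"
  shows "\<exists>P f. P \<in> carrier_mat n n \<and> similar_mat_wit A (mat_diag n f) P (transpose_mat P)"
  using assms
proof (induction n arbitrary: A)
  case 0
  have "A = mat_diag 0 (\<lambda>_. 0)" using 0 by (intro eq_matI) (auto simp: mat_diag_def)
  moreover have "similar_mat_wit A A (1\<^sub>m 0) (transpose_mat (1\<^sub>m 0))"
    using similar_mat_wit_refl[OF 0(1)] by simp
  ultimately show ?case using one_carrier_mat by metis
next
  case (Suc n)
  note A = Suc.prems(1) and sym = Suc.prems(2)
  obtain a u where u: "u \<in> carrier_vec (Suc n)" "u \<bullet> u = 1" "A *\<^sub>v u = a \<cdot>\<^sub>v u"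
    by (rule real_symmetric_eigenvector_exists[OF A sym]) auto
  obtain H where H: "H \<in> carrier_mat (Suc n) (Suc n)" and Ht: "transpose_mat H = H"
    and HH: "H * H = 1\<^sub>m (Suc n)" and He: "H *\<^sub>v unit_vec (Suc n) 0 = u"
    by (rule householder_reflection_exists[OF u(1,2)]) auto
  let ?e = "unit_vec (Suc n) 0 :: real vec"
  define B where "B = H * A * H"
  have B: "B \<in> carrier_mat (Suc n) (Suc n)" using H A by (simp add: B_def)
  have Bt: "transpose_mat B = B"
  proof -
    have "transpose_mat B = transpose_mat H * transpose_mat (H * A)"
      unfolding B_def by (rule transpose_mult) (use H A in auto)
    also have "transpose_mat (H * A) = transpose_mat A * transpose_mat H"
      by (rule transpose_mult) (use H A in auto)
    finally show ?thesis using H A by (simp add: B_def Ht sym)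
  qed
  have "H *\<^sub>v u = ?e"
  proof -
    have "H *\<^sub>v u = (H * H) *\<^sub>v ?e" using H He by (simp add: assoc_mult_mat_vec[of _ "Suc n" "Suc n" _ "Suc n"])
    thus ?thesis using HH by simp
  qed
  have "B *\<^sub>v ?e = H *\<^sub>v (A *\<^sub>v (H *\<^sub>v ?e))"
    using H A by (simp add: B_def assoc_mult_mat_vec[of _ "Suc n" "Suc n" _ "Suc n"])
  also have "\<dots> = a \<cdot>\<^sub>v ?e" using H u \<open>H *\<^sub>v u = ?e\<close> by (simp add: He mult_mat_vec)
  finally have Be: "B *\<^sub>v ?e = a \<cdot>\<^sub>v ?e" .
  have col: "B $$ (i,0) = (if i = 0 then a else 0)" if "i < Suc n" for i
    using arg_cong[OF Be, of "\<lambda>v. v $ i"] that B by auto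
  have row: "B $$ (0,j) = (if j = 0 then a else 0)" if "j < Suc n" for j
    using col[OF that] arg_cong[OF Bt, of "\<lambda>M. M $$ (0,j)"] B that by auto
  define B' where "B' = mat n n (\<lambda>(i,j). B $$ (Suc i, Suc j))"
  have B': "B' \<in> carrier_mat n n" by (simp add: B'_def)
  have B't: "transpose_mat B' = B'"
  proof (rule eq_matI)
    fix i j assume "i < dim_row B'" "j < dim_col B'"
    thus "transpose_mat B' $$ (i,j) = B' $$ (i,j)"
      using arg_cong[OF Bt, of "\<lambda>M. M $$ (Suc i, Suc j)"] B by (auto simp: B'_def)
  qed (auto simp: B'_def)
  obtain P f where P: "P \<in> carrier_mat n n"
    and sim: "similar_mat_wit B' (mat_diag n f) P (transpose_mat P)"
    using Suc.IH[OF B' B't] by blast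
  define g where "g = case_nat a f"
  define Z where "Z = (0\<^sub>m 1 n :: real mat)"
  define Z' where "Z' = (0\<^sub>m n 1 :: real mat)"
  define M where "M = mat 1 1 (\<lambda>_. a)"
  define Q where "Q = four_block_mat (1\<^sub>m 1) Z Z' P"
  have Q: "Q \<in> carrier_mat (Suc n) (Suc n)" using P by (auto simp: Q_def)
  have blockB: "B = four_block_mat M Z Z' B'"
    using B by (intro eq_matI) (auto simp: M_def Z_def Z'_def B'_def col row)
  have blockD: "mat_diag (Suc n) g = four_block_mat M Z Z' (mat_diag n f)"
    by (intro eq_matI) (auto simp: M_def Z_def Z'_def mat_diag_def g_def split: nat.splits)
  have Qt: "transpose_mat Q = four_block_mat (1\<^sub>m 1) Z Z' (transpose_mat P)"
    using P by (intro eq_matI) (auto simp: Q_def Z_def Z'_def)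
  have "similar_mat_wit B (mat_diag (Suc n) g) Q (transpose_mat Q)"
    unfolding blockB blockD Qt unfolding Q_def Z_def Z'_def
    by (rule similar_mat_wit_four_block[OF similar_mat_wit_refl sim])
       (use P B' in \<open>auto simp: M_def\<close>)
  moreover have "similar_mat_wit A B H H"
  proof (rule similar_mat_witI[of _ _ "Suc n"])
    have "H * B * H = (H * H) * A * (H * H)"
      using H A by (simp add: B_def assoc_mult_mat[of _ "Suc n" "Suc n" _ "Suc n" _ "Suc n"])
    thus "A = H * B * H" using A HH by simp
  qed (use H A B HH in auto)
  ultimately have "similar_mat_wit A (mat_diag (Suc n) g) (H * Q) (transpose_mat Q * H)"
    by (rule similar_mat_wit_trans[rotated])
  moreover have "transpose_mat Q * H = transpose_mat (H * Q)"
    using transpose_mult[OF H Q] by (simp add: Ht)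
  ultimately show ?case using H Q by (metis mult_carrier_mat)
qed

lemma proots_prod_linear_factors:
  fixes xs :: "'a :: idom list"
  shows "proots (\<Prod>a\<leftarrow>xs. [:- a, 1:]) = mset xs"
proof (induction xs)
  case (Cons a xs)
  have "(\<Prod>a\<leftarrow>xs. [:- a, 1:]) \<noteq> 0" by (auto simp: prod_list_zero_iff)
  hence "proots ([:- a, 1:] * (\<Prod>a\<leftarrow>xs. [:- a, 1:])) = {#a#} + mset xs"
    using Cons by (subst proots_mult) (auto simp del: mult_pCons_left)
  thus ?case by simp
qed simp

text \<open>
  One half of the Courant-Fischer principle: the columns of \<open>X\<close> span an \<open>l\<close>-dimensional space.  In
  an orthonormal eigenbasis, fewer than \<open>l\<close> coordinates belong to eigenvalues that are at least
  \<open>\<mu>\<close>, so these coordinates vanish simultaneously at some nonzero vector of the space.  There the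
  quadratic form of \<open>A\<close> is strictly below \<open>\<mu>\<close> times the squared norm.
\<close>

theorem eigenvalue_count_of_quadratic_form:
  fixes A X :: "real mat"
  assumes A: "A \<in> carrier_mat n n" and sym: "transpose_mat A = A"
    and X: "X \<in> carrier_mat n l"
    and inj: "\<And>c. c \<in> carrier_vec l \<Longrightarrow> c \<noteq> 0\<^sub>v l \<Longrightarrow> X *\<^sub>v c \<noteq> 0\<^sub>v n"
    and form: "\<And>c. c \<in> carrier_vec l \<Longrightarrow>
      \<mu> * ((X *\<^sub>v c) \<bullet> (X *\<^sub>v c)) \<le> (X *\<^sub>v c) \<bullet> (A *\<^sub>v (X *\<^sub>v c))"
  shows "l \<le> size (filter_mset (\<lambda>a. \<mu> \<le> a) (proots (char_poly A)))"
proof (rule ccontr)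
  assume few: "\<not> ?thesis"
  obtain P f where P: "P \<in> carrier_mat n n"
    and sim: "similar_mat_wit A (mat_diag n f) P (transpose_mat P)"
    using real_symmetric_diagonalization[OF A sym] by blast
  have wit: "P * transpose_mat P = 1\<^sub>m n" "A = P * mat_diag n f * transpose_mat P"
    using similar_mat_witD2[OF A sim] by blast+
  let ?D = "mat_diag n f"
  let ?Pt = "transpose_mat P"
  have "char_poly A = char_poly ?D"
    by (rule char_poly_similar) (use sim in \<open>auto simp: similar_mat_def\<close>)
  also have "\<dots> = (\<Prod>a\<leftarrow>diag_mat ?D. [:- a, 1:])"
    by (rule char_poly_upper_triangular[of _ n]) (auto simp: mat_diag_def)
  also have "diag_mat ?D = map f [0..<n]" by (auto simp: diag_mat_def mat_diag_def)
  finally have roots: "proots (char_poly A) = mset (map f [0..<n])"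
    by (simp only: proots_prod_linear_factors)
  define js where "js = filter (\<lambda>j. \<mu> \<le> f j) [0..<n]"
  have "filter_mset (\<lambda>a. \<mu> \<le> a) (proots (char_poly A)) = mset (map f js)"
    unfolding roots js_def by (simp only: mset_filter[symmetric] filter_map o_def)
  hence len: "length js < l" using few by simp
  define Y where "Y = ?Pt * X"
  have Y: "Y \<in> carrier_mat n l" using P X by (simp add: Y_def)
  \<comment> \<open>The rows of \<open>M\<close> are the coordinates with eigenvalue at least \<open>\<mu>\<close>, padded by zero rows.  At
    least one row is padding, which makes \<open>M\<close> singular; row \<open>length js\<close> is singled out as a
    witness for this.\<close>
  define M where "M = mat\<^sub>r l l (\<lambda>r. if r = length js then 0\<^sub>v l else if r < length js then row Y (js ! r) else 0\<^sub>v l)"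
  have "det M = 0" unfolding M_def
    by (rule det_row_0) (use len Y in \<open>auto\<close>)
  then obtain c where c: "c \<in> carrier_vec l" "c \<noteq> 0\<^sub>v l" "M *\<^sub>v c = 0\<^sub>v l"
    using det_0_iff_vec_prod_zero[of M l] by (auto simp: M_def)
  define w where "w = X *\<^sub>v c"
  define y where "y = ?Pt *\<^sub>v w"
  have w: "w \<in> carrier_vec n" using X c by (simp add: w_def)
  have y: "y \<in> carrier_vec n" using P w by (simp add: y_def)
  have yY: "y = Y *\<^sub>v c" using P X c by (simp add: y_def w_def Y_def assoc_mult_mat_vec[of _ n n _ l])
  have y0: "y $ j = 0" if j: "j < n" "\<mu> \<le> f j" for j
  proof -
    have "j \<in> set js" using j by (simp add: js_def)
    then obtain r where r: "r < length js" "js ! r = j" by (auto simp: in_set_conv_nth)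
    have "(M *\<^sub>v c) $ r = row M r \<bullet> c" using r len by (simp add: M_def)
    also have "row M r = row Y j" using r len Y by (auto simp: M_def)
    finally have "row Y j \<bullet> c = 0" using c r len by simp
    thus ?thesis using Y j by (simp add: yY)
  qed
  have Py: "P *\<^sub>v y = w"
    using P w wit(1) by (simp add: y_def assoc_mult_mat_vec[symmetric, of _ n n _ n])
  have "w \<bullet> (A *\<^sub>v w) = w \<bullet> (P *\<^sub>v (?D *\<^sub>v y))"
    using P w unfolding wit(2) y_def
    by (simp add: assoc_mult_mat_vec[of _ n n _ n])
  also have "\<dots> = y \<bullet> (?D *\<^sub>v y)"
    unfolding y_def by (rule transpose_vec_mult_scalar[symmetric, OF P]) (use P w y in \<open>auto intro!: mult_mat_vec_carrier[of _ n n]\<close>)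
  also have "\<dots> = (\<Sum>j<n. f j * (y $ j)\<^sup>2)"
  proof -
    have "(?D *\<^sub>v y) $ j = f j * y $ j" if "j < n" for j
    proof -
      have "(?D *\<^sub>v y) $ j = (\<Sum>i<n. (if j = i then f i else 0) * y $ i)"
        using that y by (simp add: mat_diag_def scalar_prod_def lessThan_atLeast0)
      also have "\<dots> = (\<Sum>i<n. if i = j then f j * y $ j else 0)"
        by (intro sum.cong) auto
      finally have "(?D *\<^sub>v y) $ j = (\<Sum>i<n. if i = j then f j * y $ j else 0)" .
      thus ?thesis using that by simp
    qed
    thus ?thesis using y unfolding scalar_prod_def
      by (auto simp: mat_diag_def lessThan_atLeast0 power2_eq_square intro!: sum.cong)
  qed
  finally have wAw: "w \<bullet> (A *\<^sub>v w) = (\<Sum>j<n. f j * (y $ j)\<^sup>2)" .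
  have "w \<bullet> w = w \<bullet> (P *\<^sub>v y)" by (simp add: Py)
  also have "\<dots> = y \<bullet> y"
    unfolding y_def by (rule transpose_vec_mult_scalar[symmetric, OF P]) (use P w in auto)
  also have "\<dots> = (\<Sum>j<n. (y $ j)\<^sup>2)"
    using y by (simp add: scalar_prod_def lessThan_atLeast0 power2_eq_square)
  finally have ww: "w \<bullet> w = (\<Sum>j<n. (y $ j)\<^sup>2)" .
  have "(\<Sum>j<n. (\<mu> - f j) * (y $ j)\<^sup>2) \<le> 0"
    using form[OF c(1)] unfolding w_def[symmetric] wAw ww
    by (simp add: sum_distrib_left sum_subtractf algebra_simps)
  moreover have nn: "(\<mu> - f j) * (y $ j)\<^sup>2 \<ge> 0" if "j < n" for j
    using y0[OF that] by (cases "\<mu> \<le> f j") auto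
  ultimately have "(\<Sum>j<n. (\<mu> - f j) * (y $ j)\<^sup>2) = 0"
    by (meson sum_nonneg order_antisym lessThan_iff)
  hence "(\<mu> - f j) * (y $ j)\<^sup>2 = 0" if "j < n" for j
    using that nn by (subst (asm) sum_nonneg_eq_0_iff) auto
  hence "y $ j = 0" if "j < n" for j
    using that y0[OF that] by (cases "\<mu> \<le> f j") auto
  hence "y = 0\<^sub>v n" using y by (intro eq_vecI) auto
  hence "w = 0\<^sub>v n" using Py P by auto
  thus False using inj[OF c(1,2)] by (simp add: w_def)
qed

lemma sorted_descending_nth_ge:
  fixes M :: "'a :: linorder multiset"
  assumes "k < size (filter_mset (\<lambda>a. \<mu> \<le> a) M)"
  shows "\<mu> \<le> rev (sorted_list_of_multiset M) ! k"
proof (rule ccontr)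
  define L where "L = rev (sorted_list_of_multiset M)"
  assume "\<not> ?thesis"
  hence small: "L ! k < \<mu>" by (simp add: L_def)
  have M: "mset L = M" by (simp add: L_def)
  have desc: "L ! j \<le> L ! i" if "i \<le> j" "j < length L" for i j
  proof -
    have "sorted (rev L)" by (simp add: L_def)
    thus ?thesis using sorted_rev_nth_mono that by blast
  qed
  have "filter (\<lambda>a. \<mu> \<le> a) (drop k L) = []"
  proof (intro filter_False ballI)
    fix a assume "a \<in> set (drop k L)"
    then obtain i where "k + i < length L" "a = L ! (k + i)"
      by (metis in_set_conv_nth length_drop less_diff_conv add.commute nth_drop less_imp_le_nat
          trans_le_add2 not_le not_less_zero drop_all list.size(3))
    thus "\<not> \<mu> \<le> a" using desc[of k "k + i"] small by auto
  qed
  hence "filter (\<lambda>a. \<mu> \<le> a) L = filter (\<lambda>a. \<mu> \<le> a) (take k L)"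
    by (metis append_Nil2 append_take_drop_id filter_append)
  hence "length (filter (\<lambda>a. \<mu> \<le> a) L) \<le> k"
    by (metis length_filter_le length_take min.bounded_iff order.trans min.cobounded2)
  thus False using assms unfolding M[symmetric] by (metis mset_filter not_less size_mset)
qed

section \<open>Weights on a part of the graph cut off by one vertex\<close>

text \<open>
  The handshake lemma for the subgraph induced on \<open>C\<close>: inserting a vertex counts each of its edges
  into \<open>C\<close> once from either end.
\<close>

lemma even_sum_degrees:
  assumes "finite C" "sym E" "irrefl E"
  shows "even (\<Sum>u\<in>C. card (E `` {u} \<inter> C))"
  using assms(1)
proof (induction C rule: finite_induct)
  case (insert x C)
  have deg: "card (E `` {u} \<inter> insert x C) = card (E `` {u} \<inter> C) + (if u \<in> E `` {x} then 1 else 0)"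
    if "u \<in> C" for u
  proof (cases "(x, u) \<in> E")
    case True
    hence "E `` {u} \<inter> insert x C = insert x (E `` {u} \<inter> C)"
      using assms(2) by (auto simp: sym_def)
    thus ?thesis using True insert by simp
  next
    case False
    hence "E `` {u} \<inter> insert x C = E `` {u} \<inter> C"
      using assms(2) by (auto simp: sym_def)
    thus ?thesis using False by simp
  qed
  have "E `` {x} \<inter> insert x C = E `` {x} \<inter> C" using assms(3) by (auto simp: irrefl_def)
  moreover have "(\<Sum>u\<in>C. if u \<in> E `` {x} then 1 else 0) = card (E `` {x} \<inter> C)"
    using insert by (simp add: sum.If_cases Int_commute Collect_conj_eq[symmetric] Int_def)
  ultimately have "(\<Sum>u\<in>insert x C. card (E `` {u} \<inter> insert x C)) =
      2 * card (E `` {x} \<inter> C) + (\<Sum>u\<in>C. card (E `` {u} \<inter> C))"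
    using insert by (simp add: deg sum.distrib)
  thus ?case using insert by simp
qed simp

text \<open>
  The edge relation \<open>E\<close> of an undirected graph, seen from a set \<open>C\<close> of vertices of degree \<open>d\<close> that
  is joined to the rest of the graph only through \<open>v\<close>.  Components of a regular graph after the
  deletion of \<open>v\<close> are of this kind.
\<close>

locale pendant_part =
  fixes E :: "('a \<times> 'a) set" and C :: "'a set" and v :: 'a and d :: nat
  assumes sym: "sym E" and irrefl: "irrefl E"
    and finite: "finite C" and nonempty: "C \<noteq> {}" and v_notin: "v \<notin> C"
    and degree: "\<And>u. u \<in> C \<Longrightarrow> card (E `` {u}) = d"
    and closed: "\<And>u. u \<in> C \<Longrightarrow> E `` {u} \<subseteq> insert v C"
begin

definition boundary :: "'a set" where "boundary = E `` {v} \<inter> C"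

lemma finite_boundary: "finite boundary" and boundary_subset: "boundary \<subseteq> C"
  using finite by (auto simp: boundary_def)

lemma finite_neighbours: "u \<in> C \<Longrightarrow> finite (E `` {u})"
  using closed finite by (meson finite_insert finite_subset)

lemma inner_degree:
  assumes u: "u \<in> C"
  shows "card (E `` {u} \<inter> C) + (if u \<in> boundary then 1 else 0) = d"
proof (cases "u \<in> boundary")
  case True
  hence "(u, v) \<in> E" using sym by (auto simp: boundary_def sym_def)
  hence "E `` {u} = insert v (E `` {u} \<inter> C)" using closed[OF u] by auto
  hence "card (E `` {u}) = Suc (card (E `` {u} \<inter> C))"
    using v_notin finite by (metis IntD2 card_insert_disjoint finite_Int)
  thus ?thesis using True degree[OF u] by simp
next
  case False
  hence "(u, v) \<notin> E" using sym u by (auto simp: boundary_def sym_def)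
  hence "E `` {u} \<inter> C = E `` {u}" using closed[OF u] by auto
  thus ?thesis using False degree[OF u] by simp
qed

lemma sum_inner_degrees: "(\<Sum>u\<in>C. card (E `` {u} \<inter> C)) + card boundary = d * card C"
proof -
  have "(\<Sum>u\<in>C. card (E `` {u} \<inter> C) + (if u \<in> boundary then 1 else 0)) = (\<Sum>u\<in>C. d)"
    by (intro sum.cong refl inner_degree)
  moreover have "(\<Sum>u\<in>C. if u \<in> boundary then 1 else 0) = card boundary"
    using finite boundary_subset by (simp add: sum.If_cases Int_absorb1)
  ultimately show ?thesis by (simp add: sum.distrib mult.commute)
qed

lemma even_card_boundary: "even d \<Longrightarrow> even (card boundary)"
  using sum_inner_degrees even_sum_degrees[OF finite sym irrefl]
  by (metis even_add even_mult_iff)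

text \<open>
  A vertex of \<open>C\<close> outside the boundary has all its \<open>d\<close> neighbours in \<open>C\<close>.  If there is no such
  vertex, then \<open>C\<close> is its own boundary, and since a vertex has \<open>d - 1\<close> neighbours in \<open>C\<close>, the
  boundary has at least \<open>d\<close> elements.
\<close>

lemma card_ge:
  assumes "card boundary < d"
  shows "d + 1 \<le> card C"
proof (cases "C \<subseteq> boundary")
  case True
  hence eq: "boundary = C" using boundary_subset by blast
  obtain u where u: "u \<in> C" using nonempty by blast
  have "E `` {u} \<inter> C \<subseteq> C - {u}" using irrefl by (auto simp: irrefl_def)
  hence "card (E `` {u} \<inter> C) \<le> card C - 1"
    using card_mono[of "C - {u}"] finite u by (metis card_Diff_singleton finite_Diff)
  moreover have "card C > 0" using finite u by (auto simp: card_gt_0_iff)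
  ultimately show ?thesis using inner_degree[OF u] assms eq u by simp
next
  case False
  then obtain u where u: "u \<in> C" "u \<notin> boundary" by blast
  have "E `` {u} \<inter> C \<subseteq> C - {u}" using irrefl by (auto simp: irrefl_def)
  hence "card (E `` {u} \<inter> C) \<le> card C - 1"
    using card_mono[of "C - {u}"] finite u by (metis card_Diff_singleton finite_Diff)
  moreover have "card C > 0" using finite u by (auto simp: card_gt_0_iff)
  ultimately show ?thesis using inner_degree[OF u(1)] u by simp
qed

text \<open>
  The number \<open>\<mu>\<close> is the larger root of \<open>\<mu>\<^sup>2 = (d - 2) \<mu> + d - 1 + r\<close>, the characteristic equation
  of the quotient matrix with rows \<open>(t - 2, r)\<close> and \<open>(t, r - 1)\<close> for \<open>t = d + 1 - r\<close>.  In the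
  extremal case this matrix belongs to the equitable partition of \<open>C\<close> into the \<open>t\<close> boundary
  vertices and the \<open>r\<close> other ones, and the weight is its eigenvector \<open>(r, \<mu> - t + 2)\<close>.

  Otherwise \<open>t * (d + 2) \<le> (d + 1 - r) * |C|\<close>.  The average degree inside \<open>C\<close> is therefore at least
  \<open>d - (d + 1 - r) / (d + 2)\<close>, and this is at least \<open>\<mu>\<close> because, after isolating and squaring
  the root and clearing denominators, the difference of the two sides is \<open>4 * (d - (r - 1))\<^sup>2\<close>.
\<close>

theorem test_vector_exists:
  assumes r: "2 \<le> r" and Tr: "card boundary + r \<le> d + 1"
    and \<mu>: "\<mu> = (real d - 2 + sqrt ((real d)\<^sup>2 + 4 * real r)) / 2"
  obtains x :: "'a \<Rightarrow> real"
  where "\<And>u. u \<notin> C \<Longrightarrow> x u = 0" "\<exists>u\<in>C. x u \<noteq> 0"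
    "\<mu> * (\<Sum>u\<in>C. (x u)\<^sup>2) \<le> (\<Sum>u\<in>C. x u * (\<Sum>w\<in>E `` {u}. x w))"
proof -
  have size: "d + 1 \<le> card C" using card_ge r Tr by simp
  have root: "\<mu>\<^sup>2 = (real d - 2) * \<mu> + real d - 1 + real r"
  proof -
    have "2 * \<mu> - (real d - 2) = sqrt ((real d)\<^sup>2 + 4 * real r)" unfolding \<mu> by argo
    hence "(2 * \<mu> - (real d - 2))\<^sup>2 = (real d)\<^sup>2 + 4 * real r" by simp
    thus ?thesis by (simp add: power2_eq_square algebra_simps)
  qed
  show ?thesis
  proof (cases "card C = d + 1 \<and> card boundary + r = d + 1")
    case True
    define b where "b = \<mu> - real (card boundary) + 2"
    have "real d \<le> sqrt ((real d)\<^sup>2 + 4 * real r)" by (rule real_le_rsqrt) simp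
    hence "\<mu> \<ge> real d - 1" by (simp add: \<mu>)
    moreover have t: "real (card boundary) = real d + 1 - real r" using True by linarith
    ultimately have b: "b > 0" using r by (simp add: b_def)
    define x where "x = (\<lambda>w. if w \<in> boundary then real r else if w \<in> C then b else 0)"
    have sum_x: "(\<Sum>w\<in>S. x w) = real r * real (card (S \<inter> boundary)) + b * real (card (S \<inter> (C - boundary)))"
      if "Finite_Set.finite S" for S
    proof -
      have "(\<Sum>w\<in>S. x w) = (\<Sum>w\<in>S. (if w \<in> boundary then real r else 0) + (if w \<in> C - boundary then b else 0))"
        by (intro sum.cong) (auto simp: x_def)
      thus ?thesis using that by (simp add: sum.distrib sum.If_cases mult.commute Int_def)
    qed
    have cCT: "card (C - boundary) = r" using True card_Diff_subset[OF finite_boundary boundary_subset] by linarith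
    \<comment> \<open>A vertex off the boundary has \<open>d = |C| - 1\<close> neighbours, all of them in \<open>C\<close>.\<close>
    have all: "E `` {u} = C - {u}" if u: "u \<in> C - boundary" for u
    proof (rule card_subset_eq)
      have "(u, v) \<notin> E" using u sym by (auto simp: boundary_def sym_def)
      thus "E `` {u} \<subseteq> C - {u}" using closed[of u] u irrefl by (auto simp: irrefl_def)
      show "card (E `` {u}) = card (C - {u})" using degree[of u] u True finite by simp
    qed (use finite in auto)
    have eigen: "(\<Sum>w\<in>E `` {u}. x w) = \<mu> * x u" if u: "u \<in> C" for u
    proof (cases "u \<in> boundary")
      case uT: True
      \<comment> \<open>By symmetry, a boundary vertex is adjacent to every vertex off the boundary.\<close>
      have "C - boundary \<subseteq> E `` {u}"
      proof
        fix w assume w: "w \<in> C - boundary"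
        hence "u \<in> E `` {w}" using all[OF w] u uT by auto
        thus "w \<in> E `` {u}" using sym by (auto simp: sym_def)
      qed
      hence outer: "E `` {u} \<inter> (C - boundary) = C - boundary" by blast
      have "E `` {u} \<inter> C = (E `` {u} \<inter> boundary) \<union> (C - boundary)" using outer boundary_subset by blast
      hence "card (E `` {u} \<inter> C) = card (E `` {u} \<inter> boundary) + r"
        using finite finite_boundary cCT by (simp add: card_Un_disjoint disjoint_iff)
      hence "real (card (E `` {u} \<inter> boundary)) = real (card boundary) - 2"
        using inner_degree[OF u] uT t by simp
      hence nbrs: "real (card boundary) = real (card (E `` {u} \<inter> boundary)) + 2" by simp
      show ?thesis using uT unfolding sum_x[OF finite_neighbours[OF u]] outer cCT
        by (simp add: x_def b_def nbrs algebra_simps)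
    next
      case False
      hence uCT: "u \<in> C - boundary" using u by blast
      have "E `` {u} \<inter> boundary = boundary" "E `` {u} \<inter> (C - boundary) = (C - boundary) - {u}"
        using all[OF uCT] uCT boundary_subset by blast+
      moreover have "real (card ((C - boundary) - {u})) = real r - 1"
        using uCT finite cCT r by simp
      moreover have "real r * real (card boundary) + b * (real r - 1) = \<mu> * b"
        using root unfolding b_def t by (simp add: algebra_simps power2_eq_square)
      ultimately show ?thesis using False u
        unfolding sum_x[OF finite_neighbours[OF u]] by (simp add: x_def)
    qed
    show ?thesis
    proof (rule that[of x])
      show "x u = 0" if "u \<notin> C" for u using that boundary_subset by (auto simp: x_def)
      show "\<exists>u\<in>C. x u \<noteq> 0" using nonempty b r by (auto simp: x_def)
      show "\<mu> * (\<Sum>u\<in>C. (x u)\<^sup>2) \<le> (\<Sum>u\<in>C. x u * (\<Sum>w\<in>E `` {u}. x w))"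
        by (simp add: eigen sum_distrib_left power2_eq_square mult_ac)
    qed
  next
    case False
    have "card boundary * (d + 2) \<le> (d + 1 - r) * card C"
    proof (cases "card C = d + 1")
      case True
      hence "Suc (card boundary) \<le> d + 1 - r" using False Tr by linarith
      hence "Suc (card boundary) * (d + 1) \<le> (d + 1 - r) * card C" unfolding True by (rule mult_le_mono1)
      moreover have "card boundary \<le> d + 1" using Tr by simp
      ultimately show ?thesis by simp
    next
      case False
      hence "d + 2 \<le> card C" using size by simp
      thus ?thesis using Tr by (intro mult_le_mono) auto
    qed
    hence "real (card boundary * (d + 2)) \<le> real ((d + 1 - r) * card C)" by (rule of_nat_mono)
    hence "real (card boundary) * real (d + 2) \<le> real (d + 1 - r) * real (card C)"
      by (simp only: of_nat_mult)
    moreover have "real (d + 1 - r) = real d + 1 - real r" using Tr by (simp add: of_nat_diff)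
    ultimately have "real (card boundary) * (real d + 2) \<le> (real d + 1 - real r) * real (card C)"
      by (metis of_nat_add of_nat_numeral)
    hence few: "real (card boundary) \<le> (real d + 1 - real r) / (real d + 2) * real (card C)"
      by (simp add: field_simps)
    have "sqrt ((real d)\<^sup>2 + 4 * real r) \<le> real d + 2 * (real r + 1) / (real d + 2)"
    proof (rule real_le_lsqrt)
      have "(real d * (real d + 2) + 2 * (real r + 1))\<^sup>2 - ((real d)\<^sup>2 + 4 * real r) * (real d + 2)\<^sup>2
        = 4 * (real d - (real r - 1))\<^sup>2"
        by (simp add: power2_eq_square algebra_simps)
      hence "((real d)\<^sup>2 + 4 * real r) * (real d + 2)\<^sup>2 \<le> (real d * (real d + 2) + 2 * (real r + 1))\<^sup>2"
        by (smt (verit) zero_le_power2)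
      also have "real d * (real d + 2) + 2 * (real r + 1) =
          (real d + 2 * (real r + 1) / (real d + 2)) * (real d + 2)"
        by (simp add: field_simps)
      finally show "(real d)\<^sup>2 + 4 * real r \<le> (real d + 2 * (real r + 1) / (real d + 2))\<^sup>2"
        unfolding power_mult_distrib by (rule mult_right_le_imp_le) simp
    qed simp_all
    hence "\<mu> \<le> real d - (real d + 1 - real r) / (real d + 2)"
      by (simp add: \<mu> field_simps)
    hence "\<mu> * real (card C) \<le> (real d - (real d + 1 - real r) / (real d + 2)) * real (card C)"
      by (rule mult_right_mono) simp
    also have "\<dots> \<le> real d * real (card C) - real (card boundary)"
      using few by (simp add: algebra_simps)
    also have "\<dots> = (\<Sum>u\<in>C. real (card (E `` {u} \<inter> C)))"
      using arg_cong[OF sum_inner_degrees, of real] by simp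
    finally have avg: "\<mu> * real (card C) \<le> (\<Sum>u\<in>C. real (card (E `` {u} \<inter> C)))" .
    show ?thesis
    proof (rule that[of "\<lambda>u. if u \<in> C then 1 else 0"])
      have "(\<Sum>u\<in>C. real (card (E `` {u} \<inter> C))) =
        (\<Sum>u\<in>C. (if u \<in> C then 1 else 0) * (\<Sum>w\<in>E `` {u}. if w \<in> C then 1 else 0))"
        using finite_neighbours by (intro sum.cong) (auto simp: sum.If_cases)
      thus "\<mu> * (\<Sum>u\<in>C. (if u \<in> C then 1 else 0)\<^sup>2) \<le>
        (\<Sum>u\<in>C. (if u \<in> C then 1 else 0) * (\<Sum>w\<in>E `` {u}. if w \<in> C then 1 else 0))"
        using avg by simp
    qed (use nonempty in auto)
  qed
qed

end

section \<open>Eigenvalues of a graph from vertex-disjoint parts\<close>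

lemma (in sym_digraph) sym_arcs_ends: "sym (arcs_ends G)"
  using sym_arcs by (simp add: symmetric_def)

lemma (in loopfree_digraph) irrefl_arcs_ends: "irrefl (arcs_ends G)"
  using adj_not_same by (auto simp: irrefl_def)

lemma (in wf_digraph) arcs_ends_subset: "arcs_ends G \<subseteq> verts G \<times> verts G"
  by (auto simp: arcs_ends_conv)

lemma (in digraph) card_neighbours: "card (arcs_ends G `` {u}) = out_degree G u"
proof -
  have "inj_on (head G) (out_arcs G u)"
    by (rule inj_onI) (auto intro!: no_multi_arcs simp: arc_to_ends_def)
  moreover have "head G ` out_arcs G u = arcs_ends G `` {u}"
    by (force simp: arcs_ends_conv)
  ultimately show ?thesis unfolding out_degree_def by (metis card_image)
qed

lemma vertex_enum:
  assumes "finite (verts G)"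
  shows "distinct (vertex_enum G)" "set (vertex_enum G) = verts G"
proof -
  have "\<exists>vs. distinct vs \<and> set vs = verts G"
    using finite_distinct_list[OF assms] by blast
  hence "distinct (vertex_enum G) \<and> set (vertex_enum G) = verts G"
    unfolding vertex_enum_def by (rule someI_ex)
  thus "distinct (vertex_enum G)" "set (vertex_enum G) = verts G" by auto
qed

lemma sum_nth_distinct:
  assumes "distinct vs"
  shows "(\<Sum>i<length vs. h (vs ! i)) = sum h (set vs)"
  using sum.reindex_bij_betw[OF bij_betw_nth[OF assms refl refl]] by simp

text \<open>
  The weights are pairwise orthogonal for the inner product because the parts are disjoint, and for
  the adjacency form because no edge joins two parts.  Therefore both forms are diagonal in the
  coefficients of a linear combination, and the bound on each part carries over to their span.
\<close>

theorem graph_lambda_ge: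
  fixes G :: "('a, 'b) pre_digraph" and x :: "nat \<Rightarrow> 'a \<Rightarrow> real"
  assumes G: "graph G" and l: "l \<ge> 1"
    and sub: "\<And>k. k < l \<Longrightarrow> C k \<subseteq> verts G"
    and disj: "\<And>j k. j < l \<Longrightarrow> k < l \<Longrightarrow> j \<noteq> k \<Longrightarrow> C j \<inter> C k = {}"
    and apart: "\<And>j k u w. j < l \<Longrightarrow> k < l \<Longrightarrow> j \<noteq> k \<Longrightarrow> u \<in> C j \<Longrightarrow> w \<in> C k \<Longrightarrow> (u, w) \<notin> arcs_ends G"
    and supp: "\<And>k u. k < l \<Longrightarrow> u \<notin> C k \<Longrightarrow> x k u = 0"
    and nz: "\<And>k. k < l \<Longrightarrow> \<exists>u\<in>C k. x k u \<noteq> 0"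
    and form: "\<And>k. k < l \<Longrightarrow>
      \<mu> * (\<Sum>u\<in>C k. (x k u)\<^sup>2) \<le> (\<Sum>u\<in>C k. x k u * (\<Sum>w\<in>arcs_ends G `` {u}. x k w))"
  shows "\<mu> \<le> graph_lambda l G"
proof -
  interpret graph G by (rule G)
  define vs where "vs = vertex_enum G"
  define n where "n = length vs"
  have vs: "distinct vs" "set vs = verts G"
    using vertex_enum[OF finite_verts] by (auto simp: vs_def)
  have sum_vs: "(\<Sum>i<n. h (vs ! i)) = sum h (verts G)" for h :: "'a \<Rightarrow> real"
    using sum_nth_distinct[OF vs(1)] vs(2) by (simp add: n_def)
  define A where "A = adjacency_matrix G vs"
  have A: "A \<in> carrier_mat n n" by (simp add: A_def adjacency_matrix_def n_def)
  have At: "transpose_mat A = A"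
    using sym_arcs_ends by (intro eq_matI) (auto simp: A_def adjacency_matrix_def sym_def)
  define X where "X = mat n l (\<lambda>(i,k). x k (vs ! i))"
  have X: "X \<in> carrier_mat n l" by (simp add: X_def)
  define g where "g = (\<lambda>c u. \<Sum>k<l. c $ k * x k u)"
  have Xc: "(X *\<^sub>v c) $ i = g c (vs ! i)" if "c \<in> carrier_vec l" "i < n" for c i
    using that by (auto simp: X_def g_def scalar_prod_def lessThan_atLeast0 mult.commute intro!: sum.cong)
  have AXc: "(A *\<^sub>v (X *\<^sub>v c)) $ i = (\<Sum>w\<in>arcs_ends G `` {vs ! i}. g c w)"
    if c: "c \<in> carrier_vec l" and i: "i < n" for c i
  proof -
    have "(A *\<^sub>v (X *\<^sub>v c)) $ i =
        (\<Sum>j<n. (if (vs ! i, vs ! j) \<in> arcs_ends G then 1 else 0) * (X *\<^sub>v c) $ j)"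
      using i A X by (auto simp: A_def adjacency_matrix_def n_def scalar_prod_def lessThan_atLeast0 intro!: sum.cong)
    also have "\<dots> = (\<Sum>j<n. if (vs ! i, vs ! j) \<in> arcs_ends G then g c (vs ! j) else 0)"
      using c by (intro sum.cong) (auto simp: Xc)
    also have "\<dots> = (\<Sum>w\<in>verts G. if (vs ! i, w) \<in> arcs_ends G then g c w else 0)"
      by (rule sum_vs)
    also have "\<dots> = (\<Sum>w\<in>arcs_ends G `` {vs ! i}. g c w)"
      using arcs_ends_subset by (intro sum.mono_neutral_cong_right) auto
    finally show ?thesis .
  qed
  \<comment> \<open>A combination \<open>g\<close> agrees on part \<open>k\<close>, and on all neighbours of part \<open>k\<close>, with its \<open>k\<close>-th
    summand.\<close>
  have g_on: "g c u = c $ k * x k u" if "k < l" "\<And>j. j < l \<Longrightarrow> j \<noteq> k \<Longrightarrow> u \<notin> C j" for c k u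
  proof -
    have "g c u = (\<Sum>j<l. if j = k then c $ k * x k u else 0)"
      unfolding g_def using supp that by (intro sum.cong) auto
    thus ?thesis using that by simp
  qed
  have g_C: "g c u = c $ k * x k u" if "k < l" "u \<in> C k" for c k u
    by (rule g_on) (use that disj in auto)
  have g_nbr: "g c w = c $ k * x k w" if "k < l" "u \<in> C k" "(u, w) \<in> arcs_ends G" for c k u w
    by (rule g_on) (use that apart in auto)
  have sum_parts: "(\<Sum>i<n. h (vs ! i)) = (\<Sum>k<l. sum h (C k))"
    if "\<And>u. (\<And>k. k < l \<Longrightarrow> u \<notin> C k) \<Longrightarrow> h u = 0" for h :: "'a \<Rightarrow> real"
  proof -
    have "sum h (verts G) = sum h (\<Union>k\<in>{..<l}. C k)"
      using sub that by (intro sum.mono_neutral_right) auto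
    also have "\<dots> = (\<Sum>k<l. sum h (C k))"
      using sub disj by (intro sum.UNION_disjoint) (auto intro: finite_subset[OF _ finite_verts])
    finally show ?thesis by (simp add: sum_vs)
  qed
  have g_off: "g c u = 0" if "\<And>k. k < l \<Longrightarrow> u \<notin> C k" for c u
    unfolding g_def using that supp by (intro sum.neutral) auto
  have "l \<le> size (filter_mset (\<lambda>a. \<mu> \<le> a) (proots (char_poly A)))"
  proof (rule eigenvalue_count_of_quadratic_form[OF A At X])
    fix c :: "real vec" assume c: "c \<in> carrier_vec l" "c \<noteq> 0\<^sub>v l"
    then obtain k where k: "k < l" "c $ k \<noteq> 0"
      by (metis eq_vecI carrier_vecD index_zero_vec)
    obtain u where u: "u \<in> C k" "x k u \<noteq> 0" using nz[OF k(1)] by blast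
    then obtain i where i: "i < n" "vs ! i = u"
      using sub[OF k(1)] vs(2) unfolding n_def by (metis in_set_conv_nth subsetD)
    have "(X *\<^sub>v c) $ i \<noteq> 0" using Xc[OF c(1) i(1)] g_C[OF k(1) u(1)] k u i by simp
    thus "X *\<^sub>v c \<noteq> 0\<^sub>v n" using i by auto
  next
    fix c :: "real vec" assume c: "c \<in> carrier_vec l"
    let ?w = "X *\<^sub>v c"
    have w: "?w \<in> carrier_vec n" using X c by simp
    have "?w \<bullet> ?w = (\<Sum>i<n. ?w $ i * ?w $ i)"
      by (simp add: scalar_prod_def lessThan_atLeast0 carrier_vecD[OF w]
          del: index_mult_mat_vec dim_mult_mat_vec)
    also have "\<dots> = (\<Sum>i<n. (g c (vs ! i))\<^sup>2)"
      by (intro sum.cong refl) (simp add: Xc[OF c] power2_eq_square del: index_mult_mat_vec)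
    also have "\<dots> = (\<Sum>k<l. \<Sum>u\<in>C k. (g c u)\<^sup>2)"
      by (rule sum_parts) (simp add: g_off)
    also have "\<dots> = (\<Sum>k<l. (c $ k)\<^sup>2 * (\<Sum>u\<in>C k. (x k u)\<^sup>2))"
      by (intro sum.cong refl) (simp add: g_C power_mult_distrib sum_distrib_left)
    finally have ww: "?w \<bullet> ?w = (\<Sum>k<l. (c $ k)\<^sup>2 * (\<Sum>u\<in>C k. (x k u)\<^sup>2))" .
    have Aw: "A *\<^sub>v ?w \<in> carrier_vec n" using A w by simp
    have "?w \<bullet> (A *\<^sub>v ?w) = (\<Sum>i<n. ?w $ i * (A *\<^sub>v ?w) $ i)"
      by (simp add: scalar_prod_def lessThan_atLeast0 carrier_vecD[OF Aw]
          del: index_mult_mat_vec dim_mult_mat_vec)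
    also have "\<dots> = (\<Sum>i<n. g c (vs ! i) * (\<Sum>w\<in>arcs_ends G `` {vs ! i}. g c w))"
      by (intro sum.cong refl) (simp add: Xc[OF c] AXc[OF c] del: index_mult_mat_vec)
    also have "\<dots> = (\<Sum>k<l. \<Sum>u\<in>C k. g c u * (\<Sum>w\<in>arcs_ends G `` {u}. g c w))"
      by (rule sum_parts) (simp add: g_off)
    also have "\<dots> = (\<Sum>k<l. (c $ k)\<^sup>2 * (\<Sum>u\<in>C k. x k u * (\<Sum>w\<in>arcs_ends G `` {u}. x k w)))"
    proof (intro sum.cong refl)
      fix k assume "k \<in> {..<l}"
      hence k: "k < l" by simp
      have "(\<Sum>w\<in>arcs_ends G `` {u}. g c w) = c $ k * (\<Sum>w\<in>arcs_ends G `` {u}. x k w)"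
        if "u \<in> C k" for u
        unfolding sum_distrib_left by (intro sum.cong refl g_nbr[OF k that]) simp
      thus "(\<Sum>u\<in>C k. g c u * (\<Sum>w\<in>arcs_ends G `` {u}. g c w)) =
        (c $ k)\<^sup>2 * (\<Sum>u\<in>C k. x k u * (\<Sum>w\<in>arcs_ends G `` {u}. x k w))"
        unfolding sum_distrib_left[of "(c $ k)\<^sup>2"]
        by (intro sum.cong refl) (simp add: g_C[OF k] power2_eq_square)
    qed
    finally have wAw: "?w \<bullet> (A *\<^sub>v ?w) =
      (\<Sum>k<l. (c $ k)\<^sup>2 * (\<Sum>u\<in>C k. x k u * (\<Sum>w\<in>arcs_ends G `` {u}. x k w)))" .
    have "\<mu> * (?w \<bullet> ?w) = (\<Sum>k<l. (c $ k)\<^sup>2 * (\<mu> * (\<Sum>u\<in>C k. (x k u)\<^sup>2)))"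
      unfolding ww by (simp add: sum_distrib_left mult_ac)
    also have "\<dots> \<le> ?w \<bullet> (A *\<^sub>v ?w)"
      unfolding wAw by (intro sum_mono mult_left_mono form) auto
    finally show "\<mu> * (?w \<bullet> ?w) \<le> ?w \<bullet> (A *\<^sub>v ?w)" .
  qed
  thus ?thesis unfolding graph_lambda_def graph_eigenvalues_def A_def vs_def
    using l by (intro sorted_descending_nth_ge) simp
qed

lemma (in graph) reachable_closed:
  assumes "u \<rightarrow>\<^sup>*\<^bsub>G\<^esub> w" "u \<in> S" "\<And>a b. a \<in> S \<Longrightarrow> (a, b) \<in> arcs_ends G \<Longrightarrow> b \<in> S"
  shows "w \<in> S"
  using assms(1,2) by (induction rule: reachable_induct) (auto intro: assms(3))

text \<open>
  The graph stays symmetric after the deletion, so adjacent vertices other than \<open>v\<close> reach each other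
  and lie in the same strongly connected component.
\<close>

lemma (in graph) component_of_vertex_deletion:
  assumes S: "S \<in> pre_digraph.sccs_verts (remove_verts G {v})"
  shows "S \<noteq> {}" "S \<subseteq> verts G - {v}"
    and "\<And>u w. u \<in> S \<Longrightarrow> (u, w) \<in> arcs_ends G \<Longrightarrow> w \<in> insert v S"
proof -
  let ?H = "remove_verts G {v}"
  interpret H: wf_digraph ?H
    by unfold_locales (auto simp: remove_verts_def)
  have arcs: "arcs_ends ?H = {(a, b) \<in> arcs_ends G. a \<noteq> v \<and> b \<noteq> v}"
    by (auto simp: remove_verts_def arcs_ends_conv)
  show "S \<noteq> {}" using S by (simp add: H.in_sccs_verts_conv_reachable)
  show sub: "S \<subseteq> verts G - {v}"
    using H.sccs_verts_subsets[OF S] by (simp add: remove_verts_def)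
  fix u w assume u: "u \<in> S" and uw: "(u, w) \<in> arcs_ends G"
  show "w \<in> insert v S"
  proof (rule ccontr)
    assume "w \<notin> insert v S"
    hence "(u, w) \<in> arcs_ends ?H" "(w, u) \<in> arcs_ends ?H"
      using u uw sub sym_arcs_ends by (auto simp: arcs sym_def)
    hence "u \<rightarrow>\<^sup>*\<^bsub>?H\<^esub> w" "w \<rightarrow>\<^sup>*\<^bsub>?H\<^esub> u" by (auto intro: H.reachable_adjI)
    thus False using S u \<open>w \<notin> insert v S\<close> by (auto simp: H.in_sccs_verts_conv_reachable)
  qed
qed

text \<open>
  A second component takes at least one of the \<open>d\<close> edges at \<open>v\<close>, so at most \<open>d - 1\<close> of them lead
  into any one component; by parity, at most \<open>d - 2\<close> if \<open>d\<close> is even.  This is where the two values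
  of \<open>r\<close> come from.
\<close>

lemma (in graph) cut_vertex_lambda_bound:
  assumes conn: "Digraph_Component.connected G" and reg: "regular_graph G d"
    and d: "d \<ge> 3" and l: "l \<ge> 2" and v: "v \<in> verts G"
    and many: "card (pre_digraph.sccs (remove_verts G {v})) \<ge> l"
    and r: "r = (if even d then 3 else 2)"
  shows "(real d - 2 + sqrt ((real d)\<^sup>2 + 4 * real r)) / 2 \<le> graph_lambda l G"
proof -
  let ?H = "remove_verts G {v}"
  define \<mu> where "\<mu> = (real d - 2 + sqrt ((real d)\<^sup>2 + 4 * real r)) / 2"
  interpret H: wf_digraph ?H
    by unfold_locales (auto simp: remove_verts_def)
  define K where "K = H.sccs_verts"
  let ?E = "arcs_ends G"
  note part = component_of_vertex_deletion[of _ v, folded K_def]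
  have disj: "S \<inter> S' = {}" if "S \<in> K" "S' \<in> K" "S \<noteq> S'" for S S'
    using H.sccs_verts_disjoint that by (simp add: K_def)
  \<comment> \<open>Otherwise the component would be closed under adjacency in the whole connected graph.\<close>
  have attached: "\<exists>u\<in>S. (v, u) \<in> ?E" if S: "S \<in> K" for S
  proof (rule ccontr)
    assume no: "\<not> ?thesis"
    obtain u where u: "u \<in> S" "u \<in> verts G" using part(1,2)[OF S] by blast
    have reach: "u \<rightarrow>\<^sup>*\<^bsub>G\<^esub> v"
      using conn u v unfolding connected_def
      by (auto simp: strongly_connected_def reachable_mk_symmetric_eq[OF sym_arcs])
    have "b \<in> S" if "a \<in> S" "(a, b) \<in> ?E" for a b
      using part(3)[OF S that] that no sym_arcs_ends by (auto simp: sym_def)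
    hence "v \<in> S" by (rule reachable_closed[OF reach u(1)])
    thus False using part(2)[OF S] by blast
  qed
  have deg: "card (?E `` {u}) = d" if "u \<in> verts G" for u
    using reg that by (simp add: regular_graph_def card_neighbours)
  have "l \<le> card K" using many by (simp add: K_def H.card_sccs_verts)
  define test where "test = (\<lambda>S x. (\<forall>u. u \<notin> S \<longrightarrow> x u = 0) \<and> (\<exists>u\<in>S. x u \<noteq> 0) \<and>
      \<mu> * (\<Sum>u\<in>S. (x u)\<^sup>2) \<le> (\<Sum>u\<in>S. x u * (\<Sum>w\<in>?E `` {u}. x w)))"
  have test_ex: "\<exists>x. test S x" if S: "S \<in> K" for S
  proof -
    interpret P: pendant_part ?E S v d
    proof unfold_locales
      show "finite S" using part(2)[OF S] finite_verts by (meson finite_Diff finite_subset)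
      show "sym ?E" "irrefl ?E" by (rule sym_arcs_ends irrefl_arcs_ends)+
      show "S \<noteq> {}" "v \<notin> S" using part(1,2)[OF S] by auto
      show "card (?E `` {u}) = d" if "u \<in> S" for u using deg part(2)[OF S] that by blast
      show "?E `` {u} \<subseteq> insert v S" if "u \<in> S" for u using part(3)[OF S that] by blast
    qed
    have "\<not> K \<subseteq> {S}"
    proof
      assume "K \<subseteq> {S}"
      hence "card K \<le> 1" using card_mono[of "{S}" K] by simp
      thus False using \<open>l \<le> card K\<close> l by simp
    qed
    then obtain S' where S': "S' \<in> K" "S' \<noteq> S" by blast
    obtain u where u: "u \<in> S'" "(v, u) \<in> ?E" using attached[OF S'(1)] by blast
    have "u \<notin> P.boundary" using disj[OF S'(1) S S'(2)] u(1) by (auto simp: P.boundary_def)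
    hence "P.boundary \<subset> ?E `` {v}" using u(2) by (auto simp: P.boundary_def)
    moreover have "finite (?E `` {v})" using deg[OF v] d by (intro card_ge_0_finite) simp
    ultimately have "card P.boundary < d" using psubset_card_mono deg[OF v] by metis
    moreover have "card P.boundary \<noteq> d - 1" if "even d"
      using P.even_card_boundary[OF that] that d by auto
    ultimately have "card P.boundary + r \<le> d + 1" using d by (auto simp: r)
    moreover have "2 \<le> r" by (simp add: r)
    ultimately obtain x where "\<And>u. u \<notin> S \<Longrightarrow> x u = 0" "\<exists>u\<in>S. x u \<noteq> 0"
      "\<mu> * (\<Sum>u\<in>S. (x u)\<^sup>2) \<le> (\<Sum>u\<in>S. x u * (\<Sum>w\<in>?E `` {u}. x w))"
      using P.test_vector_exists[OF _ _ \<mu>_def] by blast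
    hence "test S x" by (simp add: test_def)
    thus ?thesis by blast
  qed
  define x where "x = (\<lambda>S. SOME y. test S y)"
  have x: "test S (x S)" if "S \<in> K" for S
    unfolding x_def by (rule someI_ex[OF test_ex[OF that]])
  obtain K' where K': "K' \<subseteq> K" "card K' = l" "finite K'"
    using obtain_subset_with_card_n[OF \<open>l \<le> card K\<close>] by blast
  obtain Cs where Cs: "set Cs = K'" "distinct Cs" using finite_distinct_list[OF K'(3)] by blast
  have len: "length Cs = l" using Cs K'(2) distinct_card by fastforce
  have inK: "Cs ! k \<in> K" if "k < l" for k using that len Cs(1) K'(1) by auto
  have neq: "Cs ! j \<noteq> Cs ! k" if "j < l" "k < l" "j \<noteq> k" for j k
    using that len Cs(2) by (simp add: nth_eq_iff_index_eq)
  have "\<mu> \<le> graph_lambda l G"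
  proof (rule graph_lambda_ge[where C = "\<lambda>k. Cs ! k" and x = "\<lambda>k. x (Cs ! k)"])
    show "graph G" by unfold_locales
    show "Cs ! k \<subseteq> verts G" if "k < l" for k using part(2)[OF inK[OF that]] by blast
    show dj: "Cs ! j \<inter> Cs ! k = {}" if "j < l" "k < l" "j \<noteq> k" for j k
      by (rule disj[OF inK[OF that(1)] inK[OF that(2)] neq[OF that]])
    show "(u, w) \<notin> ?E" if "j < l" "k < l" "j \<noteq> k" "u \<in> Cs ! j" "w \<in> Cs ! k" for j k u w
      using part(3)[OF inK[OF that(1)] that(4)] dj[OF that(1-3)] part(2)[OF inK[OF that(2)]] that(5)
      by blast
    show "x (Cs ! k) u = 0" if "k < l" "u \<notin> Cs ! k" for k u
      using x[OF inK[OF that(1)]] that(2) by (simp add: test_def)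
    show "\<exists>u\<in>Cs ! k. x (Cs ! k) u \<noteq> 0"
      "\<mu> * (\<Sum>u\<in>Cs ! k. (x (Cs ! k) u)\<^sup>2) \<le>
        (\<Sum>u\<in>Cs ! k. x (Cs ! k) u * (\<Sum>w\<in>?E `` {u}. x (Cs ! k) w))" if "k < l" for k
      using x[OF inK[OF that]] by (simp_all add: test_def)
  qed (use l in simp)
  thus ?thesis by (simp add: \<mu>_def)
qed

theorem corollary1p2:
  fixes G :: "('a, 'b) pre_digraph" and d l :: nat
  assumes "l \<ge> 2"
    and "graph G"
    and "Digraph_Component.connected G"
    and "regular_graph G d"
    and "card (verts G) \<ge> l + 1"
    and "d \<ge> 3"
    and "graph_lambda l G <
           (if even d then (real d - 2 + sqrt ((real d)\<^sup>2 + 12)) / 2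
            else (real d - 2 + sqrt ((real d)\<^sup>2 + 8)) / 2)"
  shows "l_connectivity l G \<ge> 2"
proof (rule ccontr)
  interpret graph G by (rule assms(2))
  let ?P = "\<lambda>k. \<exists>S \<subseteq> verts G. card S = k \<and>
     (\<not> Digraph_Component.connected (remove_verts G S) \<and>
        card (pre_digraph.sccs (remove_verts G S)) \<ge> l
      \<or> card (verts (remove_verts G S)) < l)"
  assume "\<not> l_connectivity l G \<ge> 2"
  moreover have "?P (l_connectivity l G)"
    unfolding l_connectivity_def
  proof (rule LeastI)
    show "?P (card (verts G))"
      using assms(1) by (intro exI[of _ "verts G"]) (auto simp: remove_verts_def)
  qed
  ultimately obtain S where S: "S \<subseteq> verts G" "card S \<le> 1"
    "\<not> Digraph_Component.connected (remove_verts G S) \<and>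
        card (pre_digraph.sccs (remove_verts G S)) \<ge> l
      \<or> card (verts (remove_verts G S)) < l"
    by fastforce
  have fin: "finite S" using S(1) finite_verts by (rule finite_subset)
  have "card (verts (remove_verts G S)) = card (verts G) - card S"
    using fin S(1) by (simp add: remove_verts_def card_Diff_subset)
  hence S3: "\<not> Digraph_Component.connected (remove_verts G S)"
      "card (pre_digraph.sccs (remove_verts G S)) \<ge> l"
    using S(2,3) assms(5) by auto
  have "remove_verts G {} = G"
    by (rule pre_digraph.equality) (auto simp: remove_verts_def)
  hence "S \<noteq> {}" using S3(1) assms(3) by auto
  then obtain v where v: "S = {v}" using S(2) fin
    by (metis card_0_eq card_1_singletonE le_neq_implies_less less_one)
  have "(real d - 2 + sqrt ((real d)\<^sup>2 + 4 * real (if even d then 3 else 2))) / 2 \<le> graph_lambda l G"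
    by (rule cut_vertex_lambda_bound) (use assms S(1) S3(2) v in auto)
  thus False using assms(7) by (auto split: if_splits)
qed

end
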